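(* Let $f:\mathbb{R}^{n_1}\times\cdots\times\mathbb{R}^{n_m}\to\mathbb{R}$ be convex and differentiable with $L$-Lipschitz continuous gradient ($L>0$), let each $g_i:\mathbb{R}^{n_i}\to\mathbb{R}\cup\{+\infty\}$ ($i=1,\dots,m$) be proper, lower semicontinuous and convex, let $g(x)=\sum_{i=1}^m g_i(x_i)$ and $F=f+g$, and suppose $\min F$ is finite. Let $\beta\in[0,1)$ (so that $0\le\beta<\sqrt m$), fix $0<c<1$, and set $$\gamma=\frac{2(1-\beta/\sqrt{m})c}{L}.$$ Let $(x^k)_{k\ge 0}$ be generated, from deterministic initial points $x^0,x^1$ with $F(x^0),F(x^1)<+\infty$, by the stochastic scheme: for each $k\ge 1$, pick $i_k$ uniformly from $\{1,\dots,m\}$, independently of the past, set $$x_{i_k}^{k+1}=\mathbf{prox}_{\gamma g_{i_k}}\left[x_{i_k}^k-\gamma\nabla_{i_k}f(x^k)+\beta(x_{i_k}^k-x_{i_k}^{k-1})\right],$$ and $x_j^{k+1}=x_j^k$ for $j\ne i_k$. Then $$\mathbb{E}\left(\min_{0\le i\le k}\|S_\gamma(x^i)\|^2\right)=o\left(\frac1k\right)\quad\text{as }k\to\infty,$$ where $S_\gamma(x)=x-\mathbf{prox}_{\gamma g}[x-\gamma\nabla f(x)]$.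
   Context: $\|\cdot\|$ is the Euclidean norm; $x=(x_1,\dots,x_m)$ with $x_i\in\mathbb{R}^{n_i}$; $\nabla_i f$ is the gradient with respect to block $i$; $\mathbf{prox}_{\gamma h}(y)=\arg\min_z\{h(z)+\frac{1}{2\gamma}\|z-y\|^2\}$. $\min F$ denotes the minimum value of $F$. *)

theory Defs
  imports "HOL-Probability.Probability" "HOL-Library.Landau_Symbols"
begin

text \<open>
  The product of the spaces \<open>R^(n_i)\<close>, with \<open>i\<close> ranging over the finite type \<open>'m\<close>, is
  represented as \<open>real ^ 'n\<close>, where \<open>blk\<close> maps every coordinate to the block it belongs to and
  \<open>n_i = card {j. blk j = i}\<close>. The factor \<open>R^(n_i)\<close> is identified with the subspace of vectors
  vanishing outside block \<open>i\<close>, with the inherited inner product and norm; \<open>x_i\<close> is then the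
  orthogonal projection of \<open>x\<close> onto that subspace.
\<close>

definition block_space :: "('n::finite \<Rightarrow> 'm) \<Rightarrow> 'm \<Rightarrow> (real ^ 'n) set" where
  "block_space blk i = {x. \<forall>j. blk j \<noteq> i \<longrightarrow> x $ j = 0}"

definition block :: "('n::finite \<Rightarrow> 'm) \<Rightarrow> 'm \<Rightarrow> real ^ 'n \<Rightarrow> real ^ 'n" where
  "block blk i x = (\<chi> j. if blk j = i then x $ j else 0)"

definition proper_on :: "'a set \<Rightarrow> ('a \<Rightarrow> ereal) \<Rightarrow> bool" where
  "proper_on V h \<longleftrightarrow> (\<forall>x\<in>V. h x \<noteq> -\<infinity>) \<and> (\<exists>x\<in>V. h x \<noteq> \<infinity>)"

definition lsc_on :: "'a::topological_space set \<Rightarrow> ('a \<Rightarrow> ereal) \<Rightarrow> bool" where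
  "lsc_on V h \<longleftrightarrow> (\<forall>x\<in>V. h x \<le> Liminf (at x within V) h)"

text \<open>
  The library's \<open>convex_on\<close> is restricted to real-valued functions. Extended arithmetic is
  harmless here for functions that do not take the value \<open>-\<infinity>\<close>: the only subtle case is
  \<open>0 * \<infinity> = 0\<close>, which occurs at \<open>t = 0\<close> and \<open>t = 1\<close>, where the inequality is trivial.
\<close>

definition ereal_convex_on :: "'a::real_vector set \<Rightarrow> ('a \<Rightarrow> ereal) \<Rightarrow> bool" where
  "ereal_convex_on V h \<longleftrightarrow> convex V \<and>
     (\<forall>x\<in>V. \<forall>y\<in>V. \<forall>t\<in>{0..1}.
        h ((1 - t) *\<^sub>R x + t *\<^sub>R y) \<le> ereal (1 - t) * h x + ereal t * h y)"

text \<open>The proximal operator of \<open>\<gamma> h\<close>, where \<open>h\<close> is regarded as a function on \<open>V\<close> only.\<close>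

definition prox_on :: "'a::real_normed_vector set \<Rightarrow> real \<Rightarrow> ('a \<Rightarrow> ereal) \<Rightarrow> 'a \<Rightarrow> 'a" where
  "prox_on V \<gamma> h y = arg_min_on (\<lambda>z. h z + ereal (1 / (2 * \<gamma>) * (norm (z - y))\<^sup>2)) V"

definition sep_sum :: "('n::finite \<Rightarrow> 'm::finite) \<Rightarrow> ('m \<Rightarrow> real ^ 'n \<Rightarrow> ereal) \<Rightarrow> real ^ 'n \<Rightarrow> ereal" where
  "sep_sum blk g x = (\<Sum>i\<in>UNIV. g i (block blk i x))"

definition objective ::
  "('n::finite \<Rightarrow> 'm::finite) \<Rightarrow> (real ^ 'n \<Rightarrow> real) \<Rightarrow> ('m \<Rightarrow> real ^ 'n \<Rightarrow> ereal) \<Rightarrow> real ^ 'n \<Rightarrow> ereal" where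
  "objective blk f g x = ereal (f x) + sep_sum blk g x"

text \<open>\<open>G\<close> stands for the gradient of \<open>f\<close>.\<close>

definition prox_grad_residual ::
  "('n::finite \<Rightarrow> 'm::finite) \<Rightarrow> (real ^ 'n \<Rightarrow> real ^ 'n) \<Rightarrow> ('m \<Rightarrow> real ^ 'n \<Rightarrow> ereal) \<Rightarrow> real
    \<Rightarrow> real ^ 'n \<Rightarrow> real ^ 'n" where
  "prox_grad_residual blk G g \<gamma> x = x - prox_on UNIV \<gamma> (sep_sum blk g) (x - \<gamma> *\<^sub>R G x)"

end

theory Submission
  imports Defs
begin

text \<open>
  The optimality condition of the block proximal step and the descent lemma bound
  \<open>F(x^(k+1)) - F(x^k)\<close> by \<open>(L/2 - 1/\<gamma>) (norm \<Delta>^k)^2 + (\<beta>/\<gamma>) \<langle>\<Delta>^(k-1), \<Delta>^k\<rangle>\<close>, where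
  \<open>\<Delta>^k = x^(k+1) - x^k\<close> lives in block \<open>i_k\<close>. As \<open>i_k\<close> is independent of the past, only the fraction
  \<open>1/m\<close> of \<open>(norm \<Delta>^(k-1))^2\<close> enters on average, so a weighted Young inequality shows that
  \<open>E F(x^(k+1)) + b E (norm \<Delta>^k)^2\<close> with \<open>b = \<beta> / (2 \<gamma> sqrt m)\<close> decreases by a fixed positive multiple
  of \<open>E (norm \<Delta>^k)^2\<close>, the choice of \<open>\<gamma>\<close> being exactly what makes the multiple positive. Hence
  \<open>E (norm \<Delta>^k)^2\<close> is summable. Up to an error \<open>\<beta> norm \<Delta>^(k-1)\<close> (the proximal map is nonexpansive), the
  residual is assembled from the \<open>m\<close> possible block steps, so \<open>E (norm (S x^k))^2\<close> is summable too, and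
  a nonincreasing sequence below a summable one is \<open>o(1/k)\<close>.

  The iterate \<open>x^k\<close> is a function of the finitely many possible index sequences
  \<open>i_1, \<dots>, i_(k-1)\<close>, so no measurability of the gradient or of the proximal maps is needed.
\<close>

subsection \<open>Descent and summability\<close>

text \<open>On the segment, \<open>f\<close> minus its quadratic model has nonpositive derivative by
  Cauchy-Schwarz and the Lipschitz bound, so its value at \<open>t = 1\<close> does not exceed that
  at \<open>t = 0\<close>.\<close>

lemma descent_lemma:
  fixes f :: "'a::euclidean_space \<Rightarrow> real"
  assumes G: "\<And>x. GDERIV f x :> G x" and lip: "L-lipschitz_on UNIV G"
  shows "f (x + d) \<le> f x + G x \<bullet> d + L / 2 * (norm d)\<^sup>2"
proof -
  define \<phi> where "\<phi> t = f (x + t *\<^sub>R d) - t * (G x \<bullet> d) - L / 2 * t\<^sup>2 * (norm d)\<^sup>2" for t :: real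
  have deriv: "(\<phi> has_real_derivative (G (x + t *\<^sub>R d) - G x) \<bullet> d - L * t * (norm d)\<^sup>2) (at t)" for t
  proof -
    have "((\<lambda>t. f (x + t *\<^sub>R d)) has_derivative (\<lambda>s. (s *\<^sub>R d) \<bullet> G (x + t *\<^sub>R d))) (at t)"
      by (rule has_derivative_compose[where g = f and f = "\<lambda>t. x + t *\<^sub>R d"])
        (use G in \<open>auto simp: gderiv_def intro!: derivative_eq_intros\<close>)
    then have "((\<lambda>t. f (x + t *\<^sub>R d)) has_real_derivative (G (x + t *\<^sub>R d) \<bullet> d)) (at t)"
      by (simp add: has_field_derivative_def inner_commute mult_commute_abs)
    then show ?thesis
      unfolding \<phi>_def by (auto intro!: derivative_eq_intros simp: inner_diff_left)
  qed
  have "\<phi> 1 \<le> \<phi> 0"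
  proof (rule DERIV_nonpos_imp_nonincreasing[of 0 1 \<phi>])
    fix t :: real assume t: "0 \<le> t" "t \<le> 1"
    have "(G (x + t *\<^sub>R d) - G x) \<bullet> d \<le> norm (G (x + t *\<^sub>R d) - G x) * norm d"
      by (rule norm_cauchy_schwarz)
    also have "\<dots> \<le> (L * norm (t *\<^sub>R d)) * norm d"
      using lipschitz_onD[OF lip, of "x + t *\<^sub>R d" x] by (intro mult_right_mono) (auto simp: dist_norm)
    finally have "(G (x + t *\<^sub>R d) - G x) \<bullet> d - L * t * (norm d)\<^sup>2 \<le> 0"
      using t by (simp add: power2_eq_square)
    with deriv[of t] show "\<exists>y. (\<phi> has_real_derivative y) (at t) \<and> y \<le> 0"
      by blast
  qed simp
  then show ?thesis
    by (simp add: \<phi>_def)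
qed

text \<open>The quantity \<open>e (Suc n) + b * d n\<close> loses at least
  \<open>\<kappa> * d (Suc n)\<close> per step and stays above \<open>B\<close>, so telescoping
  bounds the partial sums of \<open>d\<close>.\<close>

lemma summable_of_inertial_descent:
  fixes e d :: "nat \<Rightarrow> real"
  assumes "\<kappa> > 0" "b \<ge> 0" "\<And>k. B \<le> e k" "\<And>k. 0 \<le> d k"
    and desc: "\<And>k. e (Suc (Suc k)) + (b + \<kappa>) * d (Suc k) \<le> e (Suc k) + b * d k"
  shows "summable d"
proof -
  have telescope: "\<kappa> * (\<Sum>k<n. d (Suc k)) \<le> e 1 + b * d 0 - (e (Suc n) + b * d n)" for n
  proof (induction n)
    case (Suc n)
    then show ?case
      using desc[of n] by (simp add: algebra_simps)
  qed simp
  have "(\<Sum>k<n. d (Suc k)) \<le> (e 1 + b * d 0 - B) / \<kappa>" for n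
  proof -
    have "0 \<le> b * d n"
      using assms by simp
    then have "\<kappa> * (\<Sum>k<n. d (Suc k)) \<le> e 1 + b * d 0 - B"
      using telescope[of n] \<open>B \<le> e (Suc n)\<close> by linarith
    then show ?thesis
      using \<open>\<kappa> > 0\<close> by (simp add: field_simps)
  qed
  then have "summable (\<lambda>k. d (Suc k))"
    using assms(4) by (intro summableI_nonneg_bounded) auto
  then show ?thesis
    by (simp add: summable_Suc_iff)
qed

text \<open>Since \<open>a n\<close> lies below every \<open>s i\<close> with
  \<open>i \<le> n\<close>, summing over a window from a fixed \<open>N\<close> to \<open>n\<close>
  bounds half of \<open>n * a n\<close> by a Cauchy tail of \<open>s\<close>.\<close>

lemma antimono_summable_bound_imp_smallo:
  fixes a s :: "nat \<Rightarrow> real"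
  assumes "antimono a" "\<And>n. 0 \<le> a n" "\<And>n. a n \<le> s n" "summable s"
  shows "a \<in> o(\<lambda>n. 1 / real n)"
proof (rule smalloI_tendsto)
  \<comment> \<open>At \<open>n = 0\<close> the rate is 0 by the convention for division, so it is
    nonzero only eventually.\<close>
  show "\<forall>\<^sub>F n in sequentially. 1 / real n \<noteq> 0"
    using eventually_gt_at_top[of 0] by eventually_elim auto
  have "(\<lambda>n. real n * a n) \<longlonglongrightarrow> 0"
  proof (rule LIMSEQ_I)
    fix e :: real assume "e > 0"
    then obtain N where N: "\<And>m n. m \<ge> N \<Longrightarrow> norm (sum s {m..<n}) < e / 2"
      using \<open>summable s\<close> unfolding summable_Cauchy by (meson half_gt_zero)
    have "norm (real n * a n - 0) < e" if n: "n \<ge> 2 * N" for n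
    proof -
      \<comment> \<open>The choice \<open>n \<ge> 2 * N\<close> makes the window
        \<open>{N..<n}\<close> at least \<open>n / 2\<close> long.\<close>
      have "real n / 2 * a n \<le> real (n - N) * a n"
        using n assms(2) by (intro mult_right_mono) (auto simp: of_nat_diff)
      also have "\<dots> = (\<Sum>i\<in>{N..<n}. a n)"
        by simp
      also have "\<dots> \<le> (\<Sum>i\<in>{N..<n}. s i)"
        by (intro sum_mono) (meson antimonoD assms(1,3) atLeastLessThan_iff less_imp_le order_trans)
      also have "\<dots> < e / 2"
        using N[of N n] by auto
      finally show ?thesis
        using assms(2) by (simp add: abs_mult)
    qed
    then show "\<exists>no. \<forall>n\<ge>no. norm (real n * a n - 0) < e"
      by blast
  qed
  then show "((\<lambda>n. a n / (1 / real n)) \<longlongrightarrow> 0) sequentially"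
    by (simp add: mult.commute)
qed

subsection \<open>Proximal points\<close>

lemma lsc_on_iff:
  "lsc_on V h \<longleftrightarrow> (\<forall>x\<in>V. \<forall>r<h x. eventually (\<lambda>z. r < h z) (at x within V))"
  by (simp add: lsc_on_def le_Liminf_iff)

lemma lsc_on_subset: "lsc_on V h \<Longrightarrow> W \<subseteq> V \<Longrightarrow> lsc_on W h"
  unfolding lsc_on_iff by (meson at_le filter_leD subsetD)

text \<open>Without a minimum, the relatively open sets \<open>{z\<in>K. h y < h z}\<close> cover
  \<open>K\<close>. In a finite subcover, the index with the least value lies in one of these sets
  itself, a contradiction.\<close>

lemma lsc_on_attains_min:
  assumes "compact K" "K \<noteq> {}" "lsc_on K h"
  shows "\<exists>x\<in>K. \<forall>y\<in>K. h x \<le> h y"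
proof (rule ccontr)
  assume "\<not> ?thesis"
  then have no_min: "\<forall>x\<in>K. \<exists>y\<in>K. h y < h x"
    by (meson not_le)
  have "\<exists>U. open U \<and> U \<inter> K = {z\<in>K. h y < h z}" for y
  proof -
    have "\<exists>T. open T \<and> x \<in> T \<and> T \<inter> K \<subseteq> {z\<in>K. h y < h z}" if "x \<in> {z\<in>K. h y < h z}" for x
    proof -
      have "eventually (\<lambda>z. h y < h z) (at x within K)"
        using assms(3) that by (auto simp: lsc_on_iff)
      then obtain S where "open S" "x \<in> S" "\<forall>z\<in>S. z \<noteq> x \<longrightarrow> z \<in> K \<longrightarrow> h y < h z"
        unfolding eventually_at_topological by auto
      \<comment> \<open>The filter \<open>at x within K\<close> leaves out \<open>x\<close>; that
        \<open>x\<close> itself belongs to the superlevel set is the assumption on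
        \<open>x\<close>.\<close>
      then show ?thesis
        using that by (intro exI[of _ S]) auto
    qed
    then obtain T where T: "\<And>x. x \<in> {z\<in>K. h y < h z} \<Longrightarrow>
        open (T x) \<and> x \<in> T x \<and> T x \<inter> K \<subseteq> {z\<in>K. h y < h z}"
      by metis
    show ?thesis
      by (rule exI[of _ "\<Union>x\<in>{z\<in>K. h y < h z}. T x"]) (use T in blast)
  qed
  then obtain U where U: "\<And>y. open (U y)" "\<And>y. U y \<inter> K = {z\<in>K. h y < h z}"
    by metis
  have "K \<subseteq> (\<Union>y\<in>K. U y)"
    using no_min U(2) by blast
  with \<open>compact K\<close> U(1) obtain D where D: "D \<subseteq> K" "finite D" "K \<subseteq> (\<Union>y\<in>D. U y)"
    by (metis compactE_image)
  with \<open>K \<noteq> {}\<close> have "D \<noteq> {}"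
    by auto
  obtain y where y: "y \<in> D" "\<And>z. z \<in> D \<Longrightarrow> h y \<le> h z"
    using ex_is_arg_min_if_finite[OF \<open>finite D\<close> \<open>D \<noteq> {}\<close>, of h]
    by (auto simp: is_arg_min_linorder)
  from y(1) D obtain y' where "y' \<in> D" "y \<in> U y'" "y \<in> K"
    by blast
  with U(2)[of y'] have "h y' < h y"
    by blast
  with y(2)[OF \<open>y' \<in> D\<close>] show False
    by auto
qed

text \<open>A real \<open>s\<close> strictly between \<open>r - q x\<close> and \<open>h x\<close>
  separates the two demands: near \<open>x\<close> both \<open>h z > s\<close> and
  \<open>s + q z > r\<close> hold.\<close>

lemma lsc_on_add_continuous:
  assumes h: "lsc_on V h" and q: "continuous_on V q" and "\<And>x. x \<in> V \<Longrightarrow> h x \<noteq> -\<infinity>"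
  shows "lsc_on V (\<lambda>x. h x + ereal (q x))"
  unfolding lsc_on_iff
proof (intro ballI allI impI)
  fix x r assume x: "x \<in> V" and r: "r < h x + ereal (q x)"
  have "r - ereal (q x) < h x"
    using r by (cases r; cases "h x") auto
  then obtain s where s: "r - ereal (q x) < ereal s" "ereal s < h x"
    using ereal_dense2 by blast
  have ev_h: "eventually (\<lambda>z. ereal s < h z) (at x within V)"
    using h x s(2) by (auto simp: lsc_on_iff)
  have q': "(q \<longlongrightarrow> q x) (at x within V)"
    using q x by (auto simp: continuous_on)
  have "eventually (\<lambda>z. r < ereal s + ereal (q z)) (at x within V)"
  proof (cases r)
    case (real r')
    then have "r' - s < q x"
      using s(1) by simp
    from order_tendstoD(1)[OF q' this] show ?thesis
      by eventually_elim (use real in auto)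
  qed (use s(1) in auto)
  with ev_h show "eventually (\<lambda>z. r < h z + ereal (q z)) (at x within V)"
  proof eventually_elim
    case (elim z)
    then have "ereal s + ereal (q z) \<le> h z + ereal (q z)"
      by (intro add_right_mono) auto
    with elim show ?case
      by (rule_tac less_le_trans)
  qed
qed

text \<open>The optimality condition \<open>(y - p) / \<gamma> \<in> \<partial>h(p)\<close>, relative to \<open>V\<close>.\<close>

definition is_prox :: "'a::real_inner set \<Rightarrow> real \<Rightarrow> ('a \<Rightarrow> ereal) \<Rightarrow> 'a \<Rightarrow> 'a \<Rightarrow> bool" where
  "is_prox V \<gamma> h y p \<longleftrightarrow> p \<in> V \<and> \<bar>h p\<bar> \<noteq> \<infinity> \<and>
     (\<forall>z\<in>V. h p + ereal (((y - p) \<bullet> (z - p)) / \<gamma>) \<le> h z)"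

lemma power2_norm_diff_via:
  fixes y :: "'a::real_inner"
  shows "(norm (z - y))\<^sup>2 = (norm (p - y))\<^sup>2 + (norm (z - p))\<^sup>2 - 2 * ((y - p) \<bullet> (z - p))"
  by (simp add: power2_norm_eq_inner inner_diff_left inner_diff_right inner_commute)

text \<open>Expanding the square around \<open>p\<close> turns the optimality condition into
  quadratic growth of the proximal objective away from \<open>p\<close>. The minimizer is therefore
  unique, which pins down the choice made by \<open>arg_min_on\<close>.\<close>

lemma is_prox_imp_prox_on_eq:
  assumes p: "is_prox V \<gamma> h y p" and "\<gamma> > 0"
  shows "prox_on V \<gamma> h y = p"
proof -
  define \<phi> where "\<phi> z = h z + ereal (1 / (2 * \<gamma>) * (norm (z - y))\<^sup>2)" for z
  have gap: "\<phi> p + ereal (1 / (2 * \<gamma>) * (norm (z - p))\<^sup>2) \<le> \<phi> z" if "z \<in> V" for z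
  proof -
    define I where "I = ((y - p) \<bullet> (z - p)) / \<gamma>"
    have "h p + ereal I + ereal (1 / (2 * \<gamma>) * (norm (z - y))\<^sup>2) \<le> \<phi> z"
      unfolding \<phi>_def I_def using p that by (intro add_right_mono) (auto simp: is_prox_def)
    moreover have "I + 1 / (2 * \<gamma>) * (norm (z - y))\<^sup>2
        = 1 / (2 * \<gamma>) * (norm (p - y))\<^sup>2 + 1 / (2 * \<gamma>) * (norm (z - p))\<^sup>2"
      unfolding I_def power2_norm_diff_via[of z y p] using \<open>\<gamma> > 0\<close> by (simp add: field_simps)
    ultimately show ?thesis
      by (simp add: \<phi>_def add.assoc)
  qed
  have fin: "\<bar>\<phi> p\<bar> \<noteq> \<infinity>" and "p \<in> V"
    using p by (auto simp: is_prox_def \<phi>_def)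
  have min_p: "\<phi> p < \<phi> z" if "z \<in> V" "z \<noteq> p" for z
  proof -
    have "0 < 1 / (2 * \<gamma>) * (norm (z - p))\<^sup>2"
      using that \<open>\<gamma> > 0\<close> by simp
    then have "\<phi> p < \<phi> p + ereal (1 / (2 * \<gamma>) * (norm (z - p))\<^sup>2)"
      using fin by (cases "\<phi> p") auto
    also note gap[OF that(1)]
    finally show ?thesis .
  qed
  have "is_arg_min \<phi> (\<lambda>x. x \<in> V) z \<longleftrightarrow> z = p" for z
    using min_p \<open>p \<in> V\<close> by (auto simp: is_arg_min_def dest: less_asym)
  then show ?thesis
    by (simp add: prox_on_def arg_min_on_def arg_min_def \<phi>_def[abs_def])
qed

text \<open>Compare \<open>p\<close> with the point \<open>w\<close> at fraction \<open>t\<close>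
  towards \<open>z\<close>, use convexity, divide by \<open>t\<close> and let \<open>t\<close> tend
  to 0: the quadratic term vanishes and the linear one remains.\<close>

lemma minimizer_is_prox:
  fixes V :: "'a::real_inner set"
  assumes conv: "ereal_convex_on V h" and fin: "\<bar>h p\<bar> \<noteq> \<infinity>" and "p \<in> V" and "\<gamma> > 0"
    and noninf: "\<And>z. z \<in> V \<Longrightarrow> h z \<noteq> -\<infinity>"
    and min: "\<And>z. z \<in> V \<Longrightarrow> h p + ereal (1 / (2 * \<gamma>) * (norm (p - y))\<^sup>2)
                           \<le> h z + ereal (1 / (2 * \<gamma>) * (norm (z - y))\<^sup>2)"
  shows "is_prox V \<gamma> h y p"
proof -
  have "h p + ereal (((y - p) \<bullet> (z - p)) / \<gamma>) \<le> h z" if z: "z \<in> V" for z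
  proof (cases "h z")
    case (real v)
    from fin obtain u where u: "h p = ereal u"
      by auto
    define I where "I = (y - p) \<bullet> (z - p)"
    \<comment> \<open>Folding the reciprocal makes the inequality below polynomial, with
      \<open>1 / \<gamma>\<close> equal to \<open>2 * \<kappa>\<close>.\<close>
    define \<kappa> where "\<kappa> = 1 / (2 * \<gamma>)"
    have step: "u + I / \<gamma> - v \<le> t * (1 / (2 * \<gamma>) * (norm (z - p))\<^sup>2)" if t: "0 < t" "t \<le> 1" for t
    proof -
      define w where "w = (1 - t) *\<^sub>R p + t *\<^sub>R z"
      have "w \<in> V"
        using conv \<open>p \<in> V\<close> z t unfolding w_def ereal_convex_on_def by (intro convexD) auto
      have "h w \<le> ereal (1 - t) * h p + ereal t * h z"
        using conv \<open>p \<in> V\<close> z t unfolding w_def ereal_convex_on_def by auto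
      then have hw: "h w \<le> ereal ((1 - t) * u + t * v)"
        by (simp add: u real)
      with noninf[OF \<open>w \<in> V\<close>] obtain w' where w': "h w = ereal w'"
        by (cases "h w") auto
      have wp: "w - p = t *\<^sub>R (z - p)"
        by (simp add: w_def algebra_simps)
      have "u + 1 / (2 * \<gamma>) * (norm (p - y))\<^sup>2 \<le> (1 - t) * u + t * v + 1 / (2 * \<gamma>) * (norm (w - y))\<^sup>2"
        using min[OF \<open>w \<in> V\<close>] hw by (simp add: u w')
      also have "(norm (w - y))\<^sup>2 = (norm (p - y))\<^sup>2 + t\<^sup>2 * (norm (z - p))\<^sup>2 - 2 * t * I"
        unfolding power2_norm_diff_via[of w y p] wp I_def by (simp add: power_mult_distrib)
      finally have "t * (u + 2 * \<kappa> * I - v) \<le> t * (t * (\<kappa> * (norm (z - p))\<^sup>2))"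
        unfolding \<kappa>_def[symmetric] by (simp add: algebra_simps power2_eq_square)
      then have "t * (u + I / \<gamma> - v) \<le> t * (t * (1 / (2 * \<gamma>) * (norm (z - p))\<^sup>2))"
        by (simp add: \<kappa>_def)
      then show ?thesis
        using t by (simp only: mult_le_cancel_left_pos)
    qed
    have "u + I / \<gamma> - v \<le> 0"
    proof (rule tendsto_lowerbound)
      show "((\<lambda>t. t * (1 / (2 * \<gamma>) * (norm (z - p))\<^sup>2)) \<longlongrightarrow> 0) (at_right 0)"
        using \<open>\<gamma> > 0\<close> by (auto intro!: tendsto_eq_intros)
      show "\<forall>\<^sub>F t in at_right 0. u + I / \<gamma> - v \<le> t * (1 / (2 * \<gamma>) * (norm (z - p))\<^sup>2)"
        unfolding eventually_at_right_field using step by (intro exI[of _ 1]) auto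
    qed simp
    then show ?thesis
      by (simp add: u real I_def)
  qed (use noninf[OF z] in auto)
  then show ?thesis
    using \<open>p \<in> V\<close> fin by (auto simp: is_prox_def)
qed

text \<open>A convex \<open>h\<close> may be unbounded below, but it falls at most linearly away
  from \<open>x0\<close>, so the quadratic term wins outside a ball. On the compact rest, lower
  semicontinuity gives a minimizer.\<close>

lemma is_prox_exists:
  fixes V :: "'a::euclidean_space set"
  assumes "closed V" and proper: "proper_on V h" and lsc: "lsc_on V h"
    and conv: "ereal_convex_on V h" and "\<gamma> > 0"
  shows "\<exists>p. is_prox V \<gamma> h y p"
proof -
  have noninf: "h z \<noteq> -\<infinity>" if "z \<in> V" for z
    using proper that by (auto simp: proper_on_def)
  obtain x0 a where x0: "x0 \<in> V" and a: "h x0 = ereal a"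
    using proper unfolding proper_on_def by (metis ereal_cases)
  have "\<exists>x \<in> V \<inter> cball x0 1. \<forall>z \<in> V \<inter> cball x0 1. h x \<le> h z"
    by (rule lsc_on_attains_min) (use \<open>closed V\<close> x0 lsc_on_subset[OF lsc] in auto)
  then obtain w where w: "w \<in> V" "\<And>z. z \<in> V \<inter> cball x0 1 \<Longrightarrow> h w \<le> h z"
    by auto
  have "h w \<le> ereal a"
    using w(2)[of x0] x0 a by auto
  with noninf[OF w(1)] obtain b where b: "h w = ereal b" "b \<le> a"
    by (cases "h w") auto
  \<comment> \<open>The segment from \<open>x0\<close> to \<open>z\<close> meets the unit sphere
    around \<open>x0\<close> at \<open>u\<close>, where \<open>h u \<ge> b\<close>; convexity at
    \<open>u\<close>, solved for \<open>h z\<close>, gives the bound.\<close>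
  have linear_bound: "ereal (a - norm (z - x0) * (a - b)) \<le> h z" if z: "z \<in> V" "norm (z - x0) > 1" for z
  proof (cases "h z")
    case (real v)
    define r where "r = norm (z - x0)"
    have r: "r > 1"
      using z by (simp add: r_def)
    define u where "u = (1 - 1 / r) *\<^sub>R x0 + (1 / r) *\<^sub>R z"
    have u_eq: "u - x0 = (1 / r) *\<^sub>R (z - x0)"
      by (simp add: u_def algebra_simps)
    have "u \<in> V"
      using conv x0 z r unfolding u_def ereal_convex_on_def by (intro convexD) auto
    moreover have "norm (u - x0) = 1"
      unfolding u_eq using r by (auto simp: r_def)
    ultimately have "h w \<le> h u"
      by (intro w(2)) (auto simp: dist_norm norm_minus_commute)
    also have "h u \<le> ereal (1 - 1 / r) * h x0 + ereal (1 / r) * h z"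
    proof -
      have "1 / r \<in> {0..1}"
        using r by auto
      then show ?thesis
        using conv x0 z unfolding u_def ereal_convex_on_def by blast
    qed
    finally have "b \<le> (1 - 1 / r) * a + 1 / r * v"
      by (simp add: a b real)
    then have "r * b \<le> (r - 1) * a + v"
      using r by (simp add: field_simps)
    then show ?thesis
      unfolding r_def[symmetric] real by (simp add: algebra_simps)
  qed (use noninf[OF z(1)] in auto)
  define q where "q z = 1 / (2 * \<gamma>) * (norm (z - y))\<^sup>2" for z
  define \<delta> where "\<delta> = norm (x0 - y)"
  \<comment> \<open>For \<open>r = norm (z - x0)\<close>, the quadratic term must make up for the
    loss \<open>r * (a - b)\<close>. The inequality \<open>(r - \<delta>)^2 \<ge> 2 * \<gamma> * r *
    (a - b) + \<delta>^2\<close> holds once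
    \<open>r \<ge> 2 * \<delta> + 2 * \<gamma> * (a - b)\<close>; the 1 secures
    \<open>linear_bound\<close>.\<close>
  define R where "R = max 1 (2 * \<delta> + 2 * \<gamma> * (a - b))"
  have far: "h x0 + ereal (q x0) \<le> h z + ereal (q z)" if z: "z \<in> V" "norm (z - x0) > R" for z
  proof -
    define r where "r = norm (z - x0)"
    have "\<delta> \<ge> 0" "0 \<le> 2 * \<gamma> * (a - b)"
      using b \<open>\<gamma> > 0\<close> by (auto simp: \<delta>_def)
    with z have r: "r > 1" "r > 2 * \<delta> + 2 * \<gamma> * (a - b)" "r > \<delta>"
      by (auto simp: R_def r_def)
    have "r \<le> norm (z - y) + \<delta>"
      unfolding r_def \<delta>_def using norm_triangle_ineq4[of "z - y" "x0 - y"] by simp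
    then have "(r - \<delta>)\<^sup>2 \<le> (norm (z - y))\<^sup>2"
      using r by (intro power_mono) auto
    moreover have "r * (2 * \<delta> + 2 * \<gamma> * (a - b)) \<le> r * r"
      using r by (intro mult_left_mono) auto
    ultimately have "2 * \<gamma> * (r * (a - b)) + \<delta>\<^sup>2 \<le> (norm (z - y))\<^sup>2"
      by (simp add: power2_eq_square algebra_simps)
    then have "1 / (2 * \<gamma>) * (2 * \<gamma> * (r * (a - b)) + \<delta>\<^sup>2) \<le> 1 / (2 * \<gamma>) * (norm (z - y))\<^sup>2"
      using \<open>\<gamma> > 0\<close> by (intro mult_left_mono) auto
    moreover have "1 / (2 * \<gamma>) * (2 * \<gamma> * (r * (a - b)) + \<delta>\<^sup>2) = r * (a - b) + q x0"
      using \<open>\<gamma> > 0\<close> by (simp add: q_def \<delta>_def field_simps)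
    ultimately have "r * (a - b) + q x0 \<le> q z"
      by (simp add: q_def)
    then have "h x0 + ereal (q x0) \<le> ereal (a - r * (a - b)) + ereal (q z)"
      by (simp add: a)
    also have "\<dots> \<le> h z + ereal (q z)"
      using linear_bound[of z] z r by (intro add_right_mono) (auto simp: r_def)
    finally show ?thesis .
  qed
  have "\<exists>x \<in> V \<inter> cball x0 R. \<forall>z \<in> V \<inter> cball x0 R. h x + ereal (q x) \<le> h z + ereal (q z)"
  proof (rule lsc_on_attains_min)
    show "V \<inter> cball x0 R \<noteq> {}"
      using x0 by (auto simp: R_def)
    show "lsc_on (V \<inter> cball x0 R) (\<lambda>z. h z + ereal (q z))"
      unfolding q_def
      by (rule lsc_on_add_continuous)
        (use lsc_on_subset[OF lsc] noninf \<open>\<gamma> > 0\<close> in \<open>auto intro!: continuous_intros\<close>)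
  qed (use \<open>closed V\<close> in auto)
  then obtain p where p: "p \<in> V" and
    p_near: "\<And>z. z \<in> V \<inter> cball x0 R \<Longrightarrow> h p + ereal (q p) \<le> h z + ereal (q z)"
    by auto
  \<comment> \<open>This comparison serves twice: it extends minimality to points outside the ball,
    and it forces \<open>h p\<close> to be finite.\<close>
  have p_x0: "h p + ereal (q p) \<le> h x0 + ereal (q x0)"
    by (rule p_near) (use x0 in \<open>auto simp: R_def\<close>)
  have "h p + ereal (q p) \<le> h z + ereal (q z)" if "z \<in> V" for z
  proof (cases "norm (z - x0) \<le> R")
    case True
    with that show ?thesis
      by (intro p_near) (auto simp: dist_norm norm_minus_commute)
  next
    case False
    with far[OF that] p_x0 show ?thesis
      by auto
  qed
  moreover have "\<bar>h p\<bar> \<noteq> \<infinity>"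
    using p_x0 a noninf[OF p] by (cases "h p") auto
  ultimately have "is_prox V \<gamma> h y p"
    using p noninf conv \<open>\<gamma> > 0\<close> unfolding q_def by (intro minimizer_is_prox) auto
  then show ?thesis ..
qed

lemma is_prox_prox_on:
  fixes V :: "'a::euclidean_space set"
  assumes "closed V" "proper_on V h" "lsc_on V h" "ereal_convex_on V h" "\<gamma> > 0"
  shows "is_prox V \<gamma> h y (prox_on V \<gamma> h y)"
  using is_prox_exists[OF assms] is_prox_imp_prox_on_eq[OF _ \<open>\<gamma> > 0\<close>] by metis

text \<open>Test each optimality condition at the other point and add: the values of
  \<open>h\<close> cancel, leaving firm nonexpansiveness, and Cauchy-Schwarz finishes.\<close>

lemma is_prox_nonexpansive:
  assumes p: "is_prox V \<gamma> h y p" and p': "is_prox V \<gamma> h y' p'" and "\<gamma> > 0"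
  shows "norm (p - p') \<le> norm (y - y')"
proof -
  obtain u u' where u: "h p = ereal u" "h p' = ereal u'"
    using p p' by (auto simp: is_prox_def)
  have "h p + ereal (((y - p) \<bullet> (p' - p)) / \<gamma>) \<le> h p'"
    "h p' + ereal (((y' - p') \<bullet> (p - p')) / \<gamma>) \<le> h p"
    using p p' by (auto simp: is_prox_def)
  then have "((y - p) \<bullet> (p' - p)) / \<gamma> + ((y' - p') \<bullet> (p - p')) / \<gamma> \<le> 0"
    by (simp add: u)
  then have "(y - p) \<bullet> (p' - p) + (y' - p') \<bullet> (p - p') \<le> 0"
    using \<open>\<gamma> > 0\<close> by (simp add: add_divide_distrib[symmetric] divide_le_0_iff)
  then have "(p - p') \<bullet> (p - p') \<le> (y - y') \<bullet> (p - p')"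
    by (simp add: inner_diff_left inner_diff_right)
  then have "norm (p - p') * norm (p - p') \<le> (y - y') \<bullet> (p - p')"
    by (simp only: power2_norm_eq_inner[symmetric] power2_eq_square)
  also have "\<dots> \<le> norm (y - y') * norm (p - p')"
    by (rule norm_cauchy_schwarz)
  finally show ?thesis
    by (cases "p = p'") auto
qed

subsection \<open>Random index sequences\<close>

text \<open>The scheme along one fixed index sequence. Iterate \<open>Suc (Suc k)\<close> is made
  with index \<open>Suc k\<close>, so iterate \<open>k\<close> reads \<open>s\<close> at
  \<open>1, ..., k - 1\<close> only.\<close>

fun momentum_iter :: "('i \<Rightarrow> 'a \<Rightarrow> 'a \<Rightarrow> 'a) \<Rightarrow> 'a \<Rightarrow> 'a \<Rightarrow> (nat \<Rightarrow> 'i) \<Rightarrow> nat \<Rightarrow> 'a" where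
  "momentum_iter T a b s 0 = a"
| "momentum_iter T a b s (Suc 0) = b"
| "momentum_iter T a b s (Suc (Suc k)) =
     T (s (Suc k)) (momentum_iter T a b s (Suc k)) (momentum_iter T a b s k)"

lemma momentum_iter_cong:
  assumes "\<And>i. i \<in> {1..<k} \<Longrightarrow> s i = s' i"
  shows "momentum_iter T a b s k = momentum_iter T a b s' k"
  using assms by (induction T a b s k rule: momentum_iter.induct) auto

lemma momentum_iter_restrict:
  "{1..<k} \<subseteq> A \<Longrightarrow> momentum_iter T a b (restrict s A) k = momentum_iter T a b s k"
  by (rule momentum_iter_cong) auto

lemma momentum_iter_invariant:
  assumes "P a" "P b" "\<And>i x y. P x \<Longrightarrow> P y \<Longrightarrow> P (T i x y)"
  shows "P (momentum_iter T a b s k)"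
  using assms by (induction T a b s k rule: momentum_iter.induct) auto

context prob_space
begin

context
  fixes idx :: "nat \<Rightarrow> 'a \<Rightarrow> 'i::finite"
  assumes indep: "indep_vars (\<lambda>_. count_space UNIV) idx {1..}"
begin

text \<open>The history takes values in the finite set \<open>?H\<close> with the discrete
  sigma-algebra, so \<open>\<phi>\<close> of it is measurable and bounded.\<close>

lemma integrable_history:
  fixes \<phi> :: "(nat \<Rightarrow> 'i) \<Rightarrow> real"
  shows "integrable M (\<lambda>\<omega>. \<phi> (restrict (\<lambda>i. idx i \<omega>) {1..<k}))"
proof -
  let ?H = "PiE {1..<k} (\<lambda>_. UNIV :: 'i set)"
  have "finite ?H"
    by (intro finite_PiE) auto
  have in_H: "restrict (\<lambda>i. idx i \<omega>) {1..<k} \<in> ?H" for \<omega>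
    by auto
  have "(\<lambda>\<omega>. restrict (\<lambda>i. idx i \<omega>) {1..<k}) \<in> measurable M (PiM {1..<k} (\<lambda>_. count_space UNIV))"
    using indep by (intro measurable_restrict) (auto simp: indep_vars_def)
  then have meas: "(\<lambda>\<omega>. restrict (\<lambda>i. idx i \<omega>) {1..<k}) \<in> measurable M (count_space ?H)"
    by (simp add: count_space_PiM_finite)
  have "(\<lambda>\<omega>. \<phi> (restrict (\<lambda>i. idx i \<omega>) {1..<k})) \<in> borel_measurable M"
    by (rule measurable_compose[OF meas]) auto
  moreover have "norm (\<phi> (restrict (\<lambda>i. idx i \<omega>) {1..<k})) \<le> Max ((\<lambda>h. norm (\<phi> h)) ` ?H)" for \<omega>
    using \<open>finite ?H\<close> in_H by (intro Max_ge) auto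
  ultimately show ?thesis
    by (intro integrable_const_bound) auto
qed

text \<open>This takes the place of conditioning on the past: split according to the value of
  \<open>idx k\<close>, whose indicators are independent of the history and have mean
  \<open>1 / CARD('i)\<close>.\<close>

lemma expectation_fresh_uniform:
  fixes \<phi> :: "'i \<Rightarrow> (nat \<Rightarrow> 'i) \<Rightarrow> real"
  assumes "k \<ge> 1" and unif: "distr M (count_space UNIV) (idx k) = uniform_count_measure UNIV"
  shows "expectation (\<lambda>\<omega>. \<phi> (idx k \<omega>) (restrict (\<lambda>i. idx i \<omega>) {1..<k}))
       = (\<Sum>i\<in>UNIV. expectation (\<lambda>\<omega>. \<phi> i (restrict (\<lambda>i. idx i \<omega>) {1..<k}))) / real CARD('i)"
proof -
  let ?h = "\<lambda>\<omega>. restrict (\<lambda>i. idx i \<omega>) {1..<k}"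
  have idx_meas: "idx k \<in> measurable M (count_space UNIV)"
    using indep \<open>k \<ge> 1\<close> by (auto simp: indep_vars_def)
  have ind_meas: "(\<lambda>\<omega>. indicator {i} (idx k \<omega>) :: real) \<in> borel_measurable M" for i
    by (rule measurable_compose[OF idx_meas]) auto
  have ind_int: "integrable M (\<lambda>\<omega>. indicator {i} (idx k \<omega>) :: real)" for i
    by (rule integrable_const_bound[where B = 1]) (use ind_meas in \<open>auto simp: indicator_def\<close>)
  have ind_exp: "expectation (\<lambda>\<omega>. indicator {i} (idx k \<omega>)) = 1 / real CARD('i)" for i
  proof -
    have "expectation (\<lambda>\<omega>. indicator {i} (idx k \<omega>) :: real)
        = integral\<^sup>L (distr M (count_space UNIV) (idx k)) (indicator {i})"
      by (rule integral_distr[symmetric, OF idx_meas]) auto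
    also have "\<dots> = 1 / real CARD('i)"
      unfolding unif by (simp add: measure_uniform_count_measure space_uniform_count_measure)
    finally show ?thesis .
  qed
  have split: "expectation (\<lambda>\<omega>. indicator {i} (idx k \<omega>) * \<phi> i (?h \<omega>))
             = 1 / real CARD('i) * expectation (\<lambda>\<omega>. \<phi> i (?h \<omega>))"
    and split_int: "integrable M (\<lambda>\<omega>. indicator {i} (idx k \<omega>) * \<phi> i (?h \<omega>))" for i
  proof -
    \<comment> \<open>Independence of disjoint subfamilies is a statement about tuples, so
      \<open>idx k\<close> enters as a tuple over \<open>{k}\<close> and is evaluated at
      \<open>k\<close> afterwards.\<close>
    have "indep_var (PiM {k} (\<lambda>_. count_space UNIV)) (\<lambda>\<omega>. restrict (\<lambda>i. idx i \<omega>) {k})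
            (PiM {1..<k} (\<lambda>_. count_space UNIV)) ?h"
      using \<open>k \<ge> 1\<close> by (intro indep_var_restrict[OF indep]) auto
    then have "indep_var borel ((\<lambda>h. indicator {i} (h k) :: real) \<circ> (\<lambda>\<omega>. restrict (\<lambda>i. idx i \<omega>) {k}))
                 borel (\<phi> i \<circ> ?h)"
      by (rule indep_var_compose) (simp_all add: count_space_PiM_finite)
    then have iv: "indep_var borel (\<lambda>\<omega>. indicator {i} (idx k \<omega>) :: real) borel (\<lambda>\<omega>. \<phi> i (?h \<omega>))"
      by (simp add: comp_def)
    show "expectation (\<lambda>\<omega>. indicator {i} (idx k \<omega>) * \<phi> i (?h \<omega>))
             = 1 / real CARD('i) * expectation (\<lambda>\<omega>. \<phi> i (?h \<omega>))"
      unfolding ind_exp[of i, symmetric]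
      by (rule indep_var_lebesgue_integral[OF iv ind_int integrable_history])
    show "integrable M (\<lambda>\<omega>. indicator {i} (idx k \<omega>) * \<phi> i (?h \<omega>))"
      by (rule indep_var_integrable[OF iv ind_int integrable_history])
  qed
  have "expectation (\<lambda>\<omega>. \<phi> (idx k \<omega>) (?h \<omega>))
      = expectation (\<lambda>\<omega>. \<Sum>i\<in>UNIV. indicator {i} (idx k \<omega>) * \<phi> i (?h \<omega>))"
    by (simp add: indicator_def sum.If_cases of_bool_def if_distrib[of "\<lambda>x. x * _"] cong: if_cong)
  also have "\<dots> = (\<Sum>i\<in>UNIV. expectation (\<lambda>\<omega>. indicator {i} (idx k \<omega>) * \<phi> i (?h \<omega>)))"
    by (rule Bochner_Integration.integral_sum) (rule split_int)
  also have "\<dots> = (\<Sum>i\<in>UNIV. expectation (\<lambda>\<omega>. \<phi> i (?h \<omega>))) / real CARD('i)"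
    unfolding split by (simp add: sum_divide_distrib)
  finally show ?thesis .
qed

end

end

subsection \<open>The inertial block proximal gradient step\<close>

lemma linear_block: "linear (block blk i)"
  by (rule linearI) (simp_all add: block_def vec_eq_iff)

lemmas block_linear_simps =
  linear_add[OF linear_block] linear_diff[OF linear_block] linear_scale[OF linear_block]
  linear_sum[OF linear_block]

lemma block_in_block_space [simp]: "block blk i x \<in> block_space blk i"
  by (simp add: block_def block_space_def)

lemma block_of_block_space:
  "x \<in> block_space blk i \<Longrightarrow> block blk j x = (if j = i then x else 0)"
  by (auto simp: block_def block_space_def vec_eq_iff)

lemma block_block: "block blk j (block blk i x) = (if j = i then block blk i x else 0)"
  by (simp add: block_of_block_space[of _ _ i])

lemma sum_block: "(\<Sum>i\<in>UNIV. block blk i x) = x"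
  for blk :: "'n::finite \<Rightarrow> 'm::finite"
  by (simp add: block_def vec_eq_iff)

lemma block_sum_block_space:
  fixes blk :: "'n::finite \<Rightarrow> 'm::finite"
  assumes "\<And>i. p i \<in> block_space blk i"
  shows "block blk j (\<Sum>i\<in>UNIV. p i) = p j"
  by (simp add: block_linear_simps block_of_block_space[OF assms])

lemma block_eqI:
  fixes blk :: "'n::finite \<Rightarrow> 'm::finite"
  assumes "\<And>i. block blk i x = block blk i y"
  shows "x = y"
proof -
  have "x = (\<Sum>i\<in>UNIV. block blk i x)"
    by (rule sum_block[symmetric])
  also have "\<dots> = y"
    unfolding assms by (rule sum_block)
  finally show ?thesis .
qed

lemma inner_block_space:
  "d \<in> block_space blk i \<Longrightarrow> x \<bullet> d = block blk i x \<bullet> d"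
  by (auto simp: inner_vec_def block_def block_space_def intro!: sum.cong)

lemma inner_eq_sum_block:
  fixes blk :: "'n::finite \<Rightarrow> 'm::finite"
  shows "x \<bullet> y = (\<Sum>i\<in>UNIV. block blk i x \<bullet> block blk i y)"
proof -
  have "x \<bullet> y = x \<bullet> (\<Sum>i\<in>UNIV. block blk i y)"
    by (simp add: sum_block)
  also have "\<dots> = (\<Sum>i\<in>UNIV. block blk i x \<bullet> block blk i y)"
    unfolding inner_sum_right by (intro sum.cong refl inner_block_space) simp
  finally show ?thesis .
qed

lemma norm_power2_eq_sum_block:
  fixes blk :: "'n::finite \<Rightarrow> 'm::finite"
  shows "(norm x)\<^sup>2 = (\<Sum>i\<in>UNIV. (norm (block blk i x))\<^sup>2)"
  unfolding power2_norm_eq_inner by (rule inner_eq_sum_block)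

lemma closed_block_space: "closed (block_space blk i)"
proof -
  have "block_space blk i = (\<Inter>j\<in>{j. blk j \<noteq> i}. {x. x $ j = 0})"
    by (auto simp: block_space_def)
  also have "closed \<dots>"
    by (intro closed_INT ballI closed_Collect_eq continuous_intros)
  finally show ?thesis .
qed

text \<open>Inner products split over the orthogonal blocks, so the blockwise optimality conditions
  add up to the one for the sum.\<close>

lemma is_prox_sep_sum:
  fixes blk :: "'n::finite \<Rightarrow> 'm::finite"
  assumes p: "\<And>i. is_prox (block_space blk i) \<gamma> (g i) (block blk i y) (p i)"
  shows "is_prox UNIV \<gamma> (sep_sum blk g) y (\<Sum>i\<in>UNIV. p i)"
proof -
  have block_p: "block blk j (\<Sum>i\<in>UNIV. p i) = p j" for j
    by (rule block_sum_block_space) (use p in \<open>auto simp: is_prox_def\<close>)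
  have "\<forall>i. \<exists>u. g i (p i) = ereal u"
    using p unfolding is_prox_def by (metis ereal_infinity_cases ereal_cases abs_ereal.simps(2,3))
  then obtain u where u: "\<And>i. g i (p i) = ereal (u i)"
    by metis
  have "sep_sum blk g (\<Sum>i\<in>UNIV. p i)
      + ereal (((y - (\<Sum>i\<in>UNIV. p i)) \<bullet> (z - (\<Sum>i\<in>UNIV. p i))) / \<gamma>) \<le> sep_sum blk g z" for z
  proof -
    have inner: "(y - (\<Sum>i\<in>UNIV. p i)) \<bullet> (z - (\<Sum>i\<in>UNIV. p i))
        = (\<Sum>i\<in>UNIV. (block blk i y - p i) \<bullet> (block blk i z - p i))"
      using inner_eq_sum_block[of "y - (\<Sum>i\<in>UNIV. p i)" _ blk]
      by (simp only: block_linear_simps(2) block_p)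
    have "sep_sum blk g (\<Sum>i\<in>UNIV. p i)
        + ereal (((y - (\<Sum>i\<in>UNIV. p i)) \<bullet> (z - (\<Sum>i\<in>UNIV. p i))) / \<gamma>)
        = (\<Sum>i\<in>UNIV. g i (p i) + ereal (((block blk i y - p i) \<bullet> (block blk i z - p i)) / \<gamma>))"
      unfolding inner sep_sum_def block_p by (simp add: u sum_divide_distrib sum.distrib)
    also have "\<dots> \<le> sep_sum blk g z"
      unfolding sep_sum_def using p by (intro sum_mono) (auto simp: is_prox_def)
    finally show ?thesis .
  qed
  then show ?thesis
    by (simp add: is_prox_def sep_sum_def block_p u)
qed

locale inertial_block_prox_grad =
  fixes blk :: "'n::finite \<Rightarrow> 'm::finite"
    and f :: "real ^ 'n \<Rightarrow> real"
    and G :: "real ^ 'n \<Rightarrow> real ^ 'n"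
    and g :: "'m \<Rightarrow> real ^ 'n \<Rightarrow> ereal"
    and L \<beta> c \<gamma> m :: real
  assumes grad: "\<And>x. GDERIV f x :> G x"
    and L_pos: "L > 0"
    and lip: "L-lipschitz_on UNIV G"
    and proper: "\<And>i. proper_on (block_space blk i) (g i)"
    and lsc: "\<And>i. lsc_on (block_space blk i) (g i)"
    and conv: "\<And>i. ereal_convex_on (block_space blk i) (g i)"
    and ex_min: "\<exists>xmin. (\<forall>x. objective blk f g xmin \<le> objective blk f g x)
               \<and> \<bar>objective blk f g xmin\<bar> \<noteq> \<infinity>"
    and \<beta>: "0 \<le> \<beta>" "\<beta> < 1"
    and c: "0 < c" "c < 1"
    and m_eq: "m = real CARD('m)"
    and \<gamma>_eq: "\<gamma> = 2 * (1 - \<beta> / sqrt m) * c / L"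
begin

text \<open>
  \<open>b\<close> is the weight of \<open>E (norm (x^(k+1) - x^k))^2\<close> in the Lyapunov function, and \<open>\<kappa>\<close> the
  decrease per step in units of the same quantity.
\<close>

definition "b = \<beta> / (2 * \<gamma> * sqrt m)"
definition "\<kappa> = 1 / \<gamma> - L / 2 - 2 * b"

section \<open>Signs of the constants\<close>

lemma m_ge_1: "m \<ge> 1"
  using finite_UNIV_card_ge_0[where 'a = 'm] by (simp add: m_eq)

lemma sqrt_m_ge_1: "sqrt m \<ge> 1"
  using m_ge_1 by simp

lemma \<beta>_ratio: "\<beta> / sqrt m < 1"
proof -
  have "\<beta> < sqrt m" "0 < sqrt m"
    using \<beta> sqrt_m_ge_1 by linarith+
  then show ?thesis
    by (simp only: divide_less_eq_1_pos)
qed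

lemma \<gamma>_pos: "\<gamma> > 0"
  unfolding \<gamma>_eq using \<beta>_ratio c L_pos by simp

lemma b_nonneg: "b \<ge> 0"
  using \<beta> \<gamma>_pos m_ge_1 by (simp add: b_def)

text \<open>As \<open>2 * b\<close> is \<open>(\<beta> / sqrt m) / \<gamma>\<close>, the difference
  \<open>1 / \<gamma> - 2 * b\<close> equals \<open>L / (2 * c)\<close> by the choice of
  \<open>\<gamma>\<close>, and \<open>c < 1\<close> puts this above \<open>L / 2\<close>.\<close>

lemma \<kappa>_pos: "\<kappa> > 0"
proof -
  have cancel: "z / (2 * z * c / L) = L / (2 * c)" if "z > 0" for z :: real
    using that c L_pos by (simp add: field_simps)
  have "\<kappa> = (1 - \<beta> / sqrt m) / \<gamma> - L / 2"
    using \<gamma>_pos sqrt_m_ge_1 by (simp add: \<kappa>_def b_def field_simps)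
  also have "(1 - \<beta> / sqrt m) / \<gamma> = L / (2 * c)"
    unfolding \<gamma>_eq using \<beta>_ratio by (intro cancel) simp
  also have "L / (2 * c) - L / 2 = L * (1 - c) / (2 * c)"
    using c by (simp add: field_simps)
  finally show ?thesis
    using c L_pos by simp
qed

section \<open>The step map and the real-valued objective\<close>

definition pstep :: "'m \<Rightarrow> real ^ 'n \<Rightarrow> real ^ 'n \<Rightarrow> real ^ 'n" where
  "pstep i x x' = prox_on (block_space blk i) \<gamma> (g i)
     (block blk i x - \<gamma> *\<^sub>R block blk i (G x) + \<beta> *\<^sub>R (block blk i x - block blk i x'))"

text \<open>\<open>x'\<close> stands for the iterate preceding \<open>x\<close>. Written this way,
  the displacement visibly lies in block \<open>i\<close>.\<close>

definition step :: "'m \<Rightarrow> real ^ 'n \<Rightarrow> real ^ 'n \<Rightarrow> real ^ 'n" where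
  "step i x x' = x + (pstep i x x' - block blk i x)"

definition feasible :: "real ^ 'n \<Rightarrow> bool" where
  "feasible x \<longleftrightarrow> (\<forall>i. \<bar>g i (block blk i x)\<bar> \<noteq> \<infinity>)"

text \<open>Real-valued so that it can be integrated. \<open>real_of_ereal\<close> sends infinities
  to 0, so the value is meaningful at feasible points only.\<close>

definition obj :: "real ^ 'n \<Rightarrow> real" where
  "obj x = f x + (\<Sum>i\<in>UNIV. real_of_ereal (g i (block blk i x)))"

lemma feasibleI:
  assumes "objective blk f g x < \<infinity>"
  shows "feasible x"
proof -
  have "g i (block blk i x) \<noteq> -\<infinity>" for i
    using proper[of i] by (simp add: proper_on_def)
  moreover have "g i (block blk i x) \<noteq> \<infinity>" for i
    using assms calculation by (auto simp: objective_def sep_sum_def sum_Pinfty)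
  ultimately show ?thesis
    by (auto simp: feasible_def)
qed

lemma objective_eq_obj: "feasible x \<Longrightarrow> objective blk f g x = ereal (obj x)"
proof -
  assume "feasible x"
  then have "\<forall>i. \<exists>u. g i (block blk i x) = ereal u"
    by (auto simp: feasible_def)
  then obtain u where "\<And>i. g i (block blk i x) = ereal (u i)"
    by metis
  then show ?thesis
    by (simp add: objective_def obj_def sep_sum_def)
qed

lemma obj_bounded_below: "\<exists>B. \<forall>x. feasible x \<longrightarrow> B \<le> obj x"
proof -
  from ex_min obtain xmin where xmin: "\<forall>x. objective blk f g xmin \<le> objective blk f g x"
    "\<bar>objective blk f g xmin\<bar> \<noteq> \<infinity>"
    by (elim exE conjE)
  have "objective blk f g xmin < \<infinity>"
    using xmin(2) by (cases "objective blk f g xmin") auto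
  then have "feasible xmin"
    by (rule feasibleI)
  then have "obj xmin \<le> obj x" if "feasible x" for x
    using xmin(1)[rule_format, of x] unfolding objective_eq_obj[OF \<open>feasible xmin\<close>]
      objective_eq_obj[OF that] by simp
  then show ?thesis
    by (intro exI[of _ "obj xmin"]) simp
qed

lemma is_prox_block: "is_prox (block_space blk i) \<gamma> (g i) y (prox_on (block_space blk i) \<gamma> (g i) y)"
  by (rule is_prox_prox_on[OF closed_block_space proper lsc conv \<gamma>_pos])

lemmas is_prox_pstep =
  is_prox_block[of i "block blk i x - \<gamma> *\<^sub>R block blk i (G x) + \<beta> *\<^sub>R (block blk i x - block blk i x')"
    for i x x', folded pstep_def]

lemma pstep_in_block_space: "pstep i x x' \<in> block_space blk i"
  using is_prox_pstep[of i x x'] by (simp add: is_prox_def)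

lemma block_step: "block blk j (step i x x') = (if j = i then pstep i x x' else block blk j x)"
  by (simp add: step_def block_linear_simps block_of_block_space[OF pstep_in_block_space] block_block)

lemma feasible_step: "feasible x \<Longrightarrow> feasible (step i x x')"
  using is_prox_pstep[of i x x'] by (auto simp: feasible_def block_step is_prox_def)

text \<open>The descent for one given index. Only block \<open>i\<close> of the previous
  displacement enters the right-hand side; its factor \<open>m\<close> cancels once \<open>i\<close>
  is averaged.\<close>

lemma obj_step_le:
  assumes "feasible x"
  shows "obj (step i x x') + (b + \<kappa>) * (norm (step i x x' - x))\<^sup>2
       \<le> obj x + m * b * (norm (block blk i (x - x')))\<^sup>2"
proof -
  define p where "p = pstep i x x'"
  define d where "d = p - block blk i x"
  define e where "e = block blk i (x - x')"
  define h where "h z j = real_of_ereal (g j (block blk j z))" for z j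
  have step_eq: "step i x x' = x + d"
    by (simp add: step_def d_def p_def)
  have d_in: "d \<in> block_space blk i"
    using pstep_in_block_space[of i x x'] block_in_block_space[of blk i x]
    by (simp add: block_space_def d_def p_def)
  have "feasible (x + d)"
    using feasible_step[OF assms, of i x'] by (simp add: step_eq)
  have block_xd: "block blk j (x + d) = (if j = i then p else block blk j x)" for j
    unfolding step_eq[symmetric] p_def by (rule block_step)
  \<comment> \<open>Optimality of \<open>p\<close> is tested at the old block. The resulting
    \<open>- G x \<bullet> d\<close> cancels the linear term of the descent lemma.\<close>
  have h_i: "h (x + d) i - h x i \<le> (1 / \<gamma>) * (\<beta> * (e \<bullet> d) - (norm d)\<^sup>2) - G x \<bullet> d"
  proof -
    have "g i p + ereal (((block blk i x - \<gamma> *\<^sub>R block blk i (G x)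
            + \<beta> *\<^sub>R (block blk i x - block blk i x') - p) \<bullet> (block blk i x - p)) / \<gamma>)
        \<le> g i (block blk i x)"
      using is_prox_pstep[of i x x'] unfolding is_prox_def p_def by simp
    moreover have "(block blk i x - \<gamma> *\<^sub>R block blk i (G x)
            + \<beta> *\<^sub>R (block blk i x - block blk i x') - p) \<bullet> (block blk i x - p)
        = (norm d)\<^sup>2 + \<gamma> * (block blk i (G x) \<bullet> d) - \<beta> * (e \<bullet> d)"
      unfolding d_def e_def block_linear_simps power2_norm_eq_inner
      by (simp add: inner_diff_left inner_diff_right inner_add_left inner_commute algebra_simps)
    moreover have "g i p = ereal (h (x + d) i)"
      using \<open>feasible (x + d)\<close> block_xd[of i] unfolding feasible_def h_def by (metis ereal_real')
    moreover have "g i (block blk i x) = ereal (h x i)"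
      using assms by (simp add: feasible_def h_def ereal_real')
    moreover have "block blk i (G x) \<bullet> d = G x \<bullet> d"
      using inner_block_space[OF d_in] by simp
    ultimately show ?thesis
      using \<gamma>_pos by (simp add: field_simps)
  qed
  have h_j: "h (x + d) j = h x j" if "j \<noteq> i" for j
    using that by (simp add: h_def block_xd)
  have "sum (h (x + d)) UNIV - sum (h x) UNIV = h (x + d) i - h x i"
    by (simp add: sum.remove[of UNIV i] h_j)
  then have "obj (x + d) - obj x = f (x + d) - f x + (h (x + d) i - h x i)"
    by (simp add: obj_def h_def)
  also have "\<dots> \<le> L / 2 * (norm d)\<^sup>2 + (1 / \<gamma>) * (\<beta> * (e \<bullet> d) - (norm d)\<^sup>2)"
    using descent_lemma[OF grad lip, of x d] h_i by linarith
  also have "\<dots> = (L / 2 - 1 / \<gamma>) * (norm d)\<^sup>2 + \<beta> / \<gamma> * (e \<bullet> d)"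
    by (simp add: algebra_simps)
  also have "\<beta> / \<gamma> * (e \<bullet> d) \<le> b * (m * (norm e)\<^sup>2 + (norm d)\<^sup>2)"
  proof -
    \<comment> \<open>The weights in Young's inequality are unequal because the uniform choice of \<open>i\<close> turns
      \<open>(norm e)^2\<close> into \<open>(norm (x - x'))^2 / m\<close> on average.\<close>
    have "0 \<le> (norm (sqrt m *\<^sub>R e - d))\<^sup>2"
      by simp
    also have "\<dots> = m * (norm e)\<^sup>2 + (norm d)\<^sup>2 - 2 * sqrt m * (e \<bullet> d)"
      using m_ge_1 unfolding power2_norm_eq_inner
      by (simp add: inner_diff_left inner_diff_right inner_commute[of d e] algebra_simps)
    finally have "b * (2 * sqrt m * (e \<bullet> d)) \<le> b * (m * (norm e)\<^sup>2 + (norm d)\<^sup>2)"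
      using b_nonneg by (intro mult_left_mono) auto
    moreover have "b * (2 * sqrt m * (e \<bullet> d)) = \<beta> / \<gamma> * (e \<bullet> d)"
      using sqrt_m_ge_1 \<gamma>_pos by (simp add: b_def field_simps)
    ultimately show ?thesis
      by simp
  qed
  finally have "obj (x + d) - obj x \<le> (L / 2 - 1 / \<gamma>) * (norm d)\<^sup>2 + b * (m * (norm e)\<^sup>2 + (norm d)\<^sup>2)"
    by simp
  then show ?thesis
    unfolding step_eq e_def[symmetric] \<kappa>_def by (simp add: algebra_simps)
qed

text \<open>All block steps from the same \<open>x\<close> and \<open>x'\<close> together form the
  full proximal point \<open>q'\<close> at the momentum-shifted \<open>y'\<close>. The residual uses
  the unshifted \<open>y\<close>, and nonexpansiveness bounds the discrepancy by
  \<open>\<beta> * norm (x - x')\<close>.\<close>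

lemma residual_le:
  "(norm (prox_grad_residual blk G g \<gamma> x))\<^sup>2
     \<le> 2 * (\<Sum>i\<in>UNIV. (norm (step i x x' - x))\<^sup>2) + 2 * \<beta>\<^sup>2 * (norm (x - x'))\<^sup>2"
proof -
  define y where "y = x - \<gamma> *\<^sub>R G x"
  define y' where "y' = y + \<beta> *\<^sub>R (x - x')"
  define q where "q = prox_on UNIV \<gamma> (sep_sum blk g) y"
  define q' where "q' = (\<Sum>i\<in>UNIV. pstep i x x')"
  \<comment> \<open>A proximal point of the full sum is assembled from the blocks; uniqueness then
    identifies it with \<open>q\<close>.\<close>
  have *: "is_prox UNIV \<gamma> (sep_sum blk g) y
      (\<Sum>i\<in>UNIV. prox_on (block_space blk i) \<gamma> (g i) (block blk i y))"
    by (rule is_prox_sep_sum[OF is_prox_block])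
  have q: "is_prox UNIV \<gamma> (sep_sum blk g) y q"
    using * unfolding q_def is_prox_imp_prox_on_eq[OF * \<gamma>_pos] .
  have q': "is_prox UNIV \<gamma> (sep_sum blk g) y' q'"
    unfolding q'_def
    by (rule is_prox_sep_sum)
      (use is_prox_pstep[of _ x x'] in \<open>simp add: y'_def y_def block_linear_simps\<close>)
  have "norm (q' - q) \<le> norm (\<beta> *\<^sub>R (x - x'))"
    using is_prox_nonexpansive[OF q' q \<gamma>_pos] by (simp add: y'_def)
  then have diff: "norm (q' - q) \<le> \<beta> * norm (x - x')"
    using \<beta> by simp
  have "norm (x - q) \<le> norm (x - q') + \<beta> * norm (x - x')"
    using norm_triangle_ineq[of "x - q'" "q' - q"] diff by simp
  then have "(norm (x - q))\<^sup>2 \<le> (norm (x - q') + \<beta> * norm (x - x'))\<^sup>2"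
    by (intro power_mono) auto
  also have "\<dots> \<le> 2 * (norm (x - q'))\<^sup>2 + 2 * (\<beta> * norm (x - x'))\<^sup>2"
    using sum_squares_bound[of "norm (x - q')" "\<beta> * norm (x - x')"] by (simp add: power2_sum)
  also have "(norm (x - q'))\<^sup>2 = (\<Sum>i\<in>UNIV. (norm (block blk i (x - q')))\<^sup>2)"
    by (rule norm_power2_eq_sum_block)
  also have "\<dots> = (\<Sum>i\<in>UNIV. (norm (step i x x' - x))\<^sup>2)"
  proof -
    have "block blk i (x - q') = - (step i x x' - x)" for i
      unfolding q'_def block_linear_simps(2) step_def
      by (simp add: block_sum_block_space pstep_in_block_space)
    then show ?thesis
      by (simp only: norm_minus_cancel)
  qed
  finally show ?thesis
    by (simp add: prox_grad_residual_def q_def y_def power_mult_distrib)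
qed

end

subsection \<open>Convergence rate\<close>

theorem theorem6:
  fixes blk :: "'n::finite \<Rightarrow> 'm::finite"
    and f :: "real ^ 'n \<Rightarrow> real"
    and G :: "real ^ 'n \<Rightarrow> real ^ 'n"
    and g :: "'m \<Rightarrow> real ^ 'n \<Rightarrow> ereal"
    and L \<beta> c \<gamma> :: real
    and M :: "'w measure"
    and idx :: "nat \<Rightarrow> 'w \<Rightarrow> 'm"
    and X :: "nat \<Rightarrow> 'w \<Rightarrow> real ^ 'n"
    and x0 x1 :: "real ^ 'n"
  assumes "surj blk"
    and "convex_on UNIV f"
    and "\<And>x. GDERIV f x :> G x"
    and "L > 0"
    and "L-lipschitz_on UNIV G"
    and "\<And>i. proper_on (block_space blk i) (g i)"
    and "\<And>i. lsc_on (block_space blk i) (g i)"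
    and "\<And>i. ereal_convex_on (block_space blk i) (g i)"
    and "\<exists>xmin. (\<forall>x. objective blk f g xmin \<le> objective blk f g x)
               \<and> \<bar>objective blk f g xmin\<bar> \<noteq> \<infinity>"
    and "0 \<le> \<beta>" "\<beta> < 1"
    and "0 < c" "c < 1"
    and "\<gamma> = 2 * (1 - \<beta> / sqrt (real CARD('m))) * c / L"
    and "objective blk f g x0 < \<infinity>"
    and "objective blk f g x1 < \<infinity>"
    and "prob_space M"
    and "prob_space.indep_vars M (\<lambda>_. count_space UNIV) idx {1..}"
    and "\<And>k. k \<ge> 1 \<Longrightarrow> distr M (count_space UNIV) (idx k) = uniform_count_measure UNIV"
    and "\<And>\<omega>. \<omega> \<in> space M \<Longrightarrow> X 0 \<omega> = x0"
    and "\<And>\<omega>. \<omega> \<in> space M \<Longrightarrow> X 1 \<omega> = x1"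
    and "\<And>k \<omega>. k \<ge> 1 \<Longrightarrow> \<omega> \<in> space M \<Longrightarrow>
           block blk (idx k \<omega>) (X (k + 1) \<omega>) =
             prox_on (block_space blk (idx k \<omega>)) \<gamma> (g (idx k \<omega>))
               (block blk (idx k \<omega>) (X k \<omega>)
                - \<gamma> *\<^sub>R block blk (idx k \<omega>) (G (X k \<omega>))
                + \<beta> *\<^sub>R (block blk (idx k \<omega>) (X k \<omega>) - block blk (idx k \<omega>) (X (k - 1) \<omega>)))"
    and "\<And>k \<omega> j. k \<ge> 1 \<Longrightarrow> \<omega> \<in> space M \<Longrightarrow> j \<noteq> idx k \<omega> \<Longrightarrow>
           block blk j (X (k + 1) \<omega>) = block blk j (X k \<omega>)"
  shows "(\<lambda>k. \<integral>\<omega>. (MIN i\<in>{0..k}. (norm (prox_grad_residual blk G g \<gamma> (X i \<omega>)))\<^sup>2) \<partial>M)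
           \<in> o(\<lambda>k. 1 / real k)"
proof -
  define m where "m = real CARD('m)"
  interpret alg: inertial_block_prox_grad blk f G g L \<beta> c \<gamma> m
    by (unfold_locales; (unfold m_def)?; (rule refl | fact assms))
  interpret prob_space M
    by fact
  note indep = assms(18) and unif = assms(19)
  let ?S = "\<lambda>x. (norm (prox_grad_residual blk G g \<gamma> x))\<^sup>2"

  \<comment> \<open>The iterates as functions of the index history\<close>
  define Y where "Y = momentum_iter alg.step x0 x1"
  define hist where "hist K \<omega> = restrict (\<lambda>i. idx i \<omega>) {1..<K}" for K \<omega>

  have X_step: "X (Suc (Suc k)) \<omega> = alg.step (idx (Suc k) \<omega>) (X (Suc k) \<omega>) (X k \<omega>)"
    if "\<omega> \<in> space M" for k \<omega>
  proof (rule block_eqI[of blk])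
    fix j
    show "block blk j (X (Suc (Suc k)) \<omega>)
        = block blk j (alg.step (idx (Suc k) \<omega>) (X (Suc k) \<omega>) (X k \<omega>))"
      using assms(22)[of "Suc k" \<omega>] assms(23)[of "Suc k" \<omega> j] that
      by (cases "j = idx (Suc k) \<omega>") (simp_all add: alg.block_step alg.pstep_def)
  qed
  \<comment> \<open>The recursion has order two, so the induction carries two consecutive
    iterates.\<close>
  have X_eq: "X k \<omega> = Y (\<lambda>i. idx i \<omega>) k \<and> X (Suc k) \<omega> = Y (\<lambda>i. idx i \<omega>) (Suc k)"
    if "\<omega> \<in> space M" for k \<omega>
    using that
  proof (induction k)
    case 0
    then show ?case
      using assms(20,21) by (simp add: Y_def)
  next
    case (Suc k)
    then show ?case
      using X_step[of \<omega> k] by (simp add: Y_def)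
  qed
  have X_hist: "X k \<omega> = Y (hist K \<omega>) k" if "\<omega> \<in> space M" "k \<le> K" for k K \<omega>
    using X_eq[OF that(1), of k] that(2) unfolding Y_def hist_def
    by (subst momentum_iter_restrict) auto
  have feas: "alg.feasible (X k \<omega>)" if "\<omega> \<in> space M" for k \<omega>
  proof -
    have "alg.feasible (Y (\<lambda>i. idx i \<omega>) k)"
      unfolding Y_def
      by (rule momentum_iter_invariant) (fact alg.feasibleI[OF assms(15)]
          alg.feasibleI[OF assms(16)] | erule alg.feasible_step)+
    then show ?thesis
      using X_eq[OF that, of k] by simp
  qed

  \<comment> \<open>Integrability and averaging over the fresh index\<close>
  have integrable_hist: "integrable M F"
    if "\<And>\<omega>. \<omega> \<in> space M \<Longrightarrow> F \<omega> = \<phi> (hist K \<omega>)" for F :: "'w \<Rightarrow> real" and \<phi> K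
    using integrable_history[OF indep, of \<phi> K] that
    by (subst Bochner_Integration.integrable_cong[OF refl]) (auto simp: hist_def)
  have int1: "integrable M (\<lambda>\<omega>. q (X k \<omega>))" for q :: "real ^ 'n \<Rightarrow> real" and k
    by (rule integrable_hist[of _ "\<lambda>h. q (Y h k)" k]) (simp add: X_hist[of _ k k])
  have int2: "integrable M (\<lambda>\<omega>. q (X (Suc k) \<omega>) (X k \<omega>))" for q :: "_ \<Rightarrow> _ \<Rightarrow> real" and k
    by (rule integrable_hist[of _ "\<lambda>h. q (Y h (Suc k)) (Y h k)" "Suc k"])
      (simp add: X_hist[of _ _ "Suc k"])
  \<comment> \<open>Here index \<open>Suc k\<close> is read as well, so the history must extend one
    place further than in \<open>int2\<close>.\<close>
  have int3: "integrable M (\<lambda>\<omega>. q (idx (Suc k) \<omega>) (X (Suc k) \<omega>) (X k \<omega>))"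
    for q :: "_ \<Rightarrow> _ \<Rightarrow> _ \<Rightarrow> real" and k
  proof (rule integrable_hist[of _ "\<lambda>h. q (h (Suc k)) (Y h (Suc k)) (Y h k)" "Suc (Suc k)"])
    fix \<omega> assume "\<omega> \<in> space M"
    then show "q (idx (Suc k) \<omega>) (X (Suc k) \<omega>) (X k \<omega>)
      = q (hist (Suc (Suc k)) \<omega> (Suc k)) (Y (hist (Suc (Suc k)) \<omega>) (Suc k)) (Y (hist (Suc (Suc k)) \<omega>) k)"
      using X_hist[of \<omega> "Suc k" "Suc (Suc k)"] X_hist[of \<omega> k "Suc (Suc k)"] by (simp add: hist_def)
  qed
  \<comment> \<open>\<open>X (Suc k)\<close> and \<open>X k\<close> depend on indices up to
    \<open>k\<close> only, hence \<open>idx (Suc k)\<close> is independent of them.\<close>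
  have fresh: "expectation (\<lambda>\<omega>. q (idx (Suc k) \<omega>) (X (Suc k) \<omega>) (X k \<omega>))
      = (\<Sum>i\<in>UNIV. expectation (\<lambda>\<omega>. q i (X (Suc k) \<omega>) (X k \<omega>))) / m"
    for q :: "_ \<Rightarrow> _ \<Rightarrow> _ \<Rightarrow> real" and k
  proof -
    define \<phi> where "\<phi> i h = q i (Y h (Suc k)) (Y h k)" for i h
    have \<phi>: "q i (X (Suc k) \<omega>) (X k \<omega>) = \<phi> i (hist (Suc k) \<omega>)" if "\<omega> \<in> space M" for i \<omega>
      using X_hist[OF that, of "Suc k" "Suc k"] X_hist[OF that, of k "Suc k"] by (simp add: \<phi>_def)
    have "expectation (\<lambda>\<omega>. \<phi> (idx (Suc k) \<omega>) (hist (Suc k) \<omega>))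
      = (\<Sum>i\<in>UNIV. expectation (\<lambda>\<omega>. \<phi> i (hist (Suc k) \<omega>))) / m"
      unfolding hist_def m_def by (rule expectation_fresh_uniform[OF indep _ unif]) auto
    then show ?thesis
      by (simp add: \<phi> cong: Bochner_Integration.integral_cong)
  qed

  \<comment> \<open>Expected descent and summability of the increments\<close>
  define e where "e k = expectation (\<lambda>\<omega>. alg.obj (X k \<omega>))" for k
  define d where "d k = expectation (\<lambda>\<omega>. (norm (X (Suc k) \<omega> - X k \<omega>))\<^sup>2)" for k
  define s where "s k = expectation (\<lambda>\<omega>. ?S (X k \<omega>))" for k
  define a where "a k = expectation (\<lambda>\<omega>. MIN i\<in>{0..k}. ?S (X i \<omega>))" for k
  have int_step: "integrable M (\<lambda>\<omega>. (norm (X (Suc k) \<omega> - X k \<omega>))\<^sup>2)" for k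
    using int2[of "\<lambda>x x'. (norm (x - x'))\<^sup>2"] .
  have m_pos: "m > 0"
    using alg.m_ge_1 by simp

  obtain B where B: "\<And>x. alg.feasible x \<Longrightarrow> B \<le> alg.obj x"
    using alg.obj_bounded_below by auto
  have "e (Suc (Suc k)) + (alg.b + alg.\<kappa>) * d (Suc k) \<le> e (Suc k) + alg.b * d k" for k
  proof -
    let ?blk = "\<lambda>\<omega>. (norm (block blk (idx (Suc k) \<omega>) (X (Suc k) \<omega> - X k \<omega>)))\<^sup>2"
    have int_blk: "integrable M ?blk"
      using int3[of "\<lambda>i x x'. (norm (block blk i (x - x')))\<^sup>2"] .
    \<comment> \<open>Averaging over the fresh index yields the sum of all squared block norms
      divided by \<open>m\<close>, and by orthogonality this sum is the full squared norm.\<close>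
    have "expectation ?blk
        = (\<Sum>i\<in>UNIV. expectation (\<lambda>\<omega>. (norm (block blk i (X (Suc k) \<omega> - X k \<omega>)))\<^sup>2)) / m"
      using fresh[of "\<lambda>i x x'. (norm (block blk i (x - x')))\<^sup>2"] .
    also have "\<dots> = expectation (\<lambda>\<omega>. \<Sum>i\<in>UNIV. (norm (block blk i (X (Suc k) \<omega> - X k \<omega>)))\<^sup>2) / m"
      using int2[of "\<lambda>x x'. (norm (block blk _ (x - x')))\<^sup>2" k]
      by (subst Bochner_Integration.integral_sum) auto
    also have "\<dots> = d k / m"
      unfolding d_def norm_power2_eq_sum_block[of "_ - _" blk, symmetric] ..
    finally have blk_d: "m * expectation ?blk = d k"
      using m_pos by simp
    have "e (Suc (Suc k)) + (alg.b + alg.\<kappa>) * d (Suc k)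
        = expectation (\<lambda>\<omega>. alg.obj (X (Suc (Suc k)) \<omega>)
            + (alg.b + alg.\<kappa>) * (norm (X (Suc (Suc k)) \<omega> - X (Suc k) \<omega>))\<^sup>2)"
      unfolding e_def d_def using int1 int_step by simp
    also have "\<dots> \<le> expectation (\<lambda>\<omega>. alg.obj (X (Suc k) \<omega>) + m * alg.b * ?blk \<omega>)"
    proof (rule integral_mono)
      fix \<omega> assume "\<omega> \<in> space M"
      then show "alg.obj (X (Suc (Suc k)) \<omega>)
            + (alg.b + alg.\<kappa>) * (norm (X (Suc (Suc k)) \<omega> - X (Suc k) \<omega>))\<^sup>2
          \<le> alg.obj (X (Suc k) \<omega>) + m * alg.b * ?blk \<omega>"
        unfolding X_step[OF \<open>\<omega> \<in> space M\<close>] by (intro alg.obj_step_le feas)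
    qed (use int1 int_step int_blk in auto)
    also have "\<dots> = e (Suc k) + alg.b * (m * expectation ?blk)"
      unfolding e_def using int1 int_blk by simp
    finally show ?thesis
      unfolding blk_d .
  qed
  moreover have "B \<le> e k" for k
    unfolding e_def by (rule integral_ge_const) (use int1 feas B in auto)
  moreover have d_nonneg: "0 \<le> d k" for k
    by (simp add: d_def)
  ultimately have "summable d"
    by (intro summable_of_inertial_descent[OF alg.\<kappa>_pos alg.b_nonneg])

  \<comment> \<open>Summability of the expected squared residuals\<close>
  have s_le: "s (Suc k) \<le> 2 * m * d (Suc k) + 2 * \<beta>\<^sup>2 * d k" for k
  proof -
    let ?q = "\<lambda>i x x'. (norm (alg.step i x x' - x))\<^sup>2"
    have int_q: "integrable M (\<lambda>\<omega>. \<Sum>i\<in>UNIV. ?q i (X (Suc k) \<omega>) (X k \<omega>))"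
      using int2[of "\<lambda>x x'. \<Sum>i\<in>UNIV. ?q i x x'" k] .
    \<comment> \<open>The step actually taken is a uniform choice among the \<open>m\<close> block
      steps, so the sum over all of them has mean \<open>m * d (Suc k)\<close>.\<close>
    have "d (Suc k) = expectation (\<lambda>\<omega>. ?q (idx (Suc k) \<omega>) (X (Suc k) \<omega>) (X k \<omega>))"
      unfolding d_def by (intro Bochner_Integration.integral_cong refl) (simp add: X_step)
    also have "\<dots> = (\<Sum>i\<in>UNIV. expectation (\<lambda>\<omega>. ?q i (X (Suc k) \<omega>) (X k \<omega>))) / m"
      by (rule fresh)
    also have "\<dots> = expectation (\<lambda>\<omega>. \<Sum>i\<in>UNIV. ?q i (X (Suc k) \<omega>) (X k \<omega>)) / m"
      using int2[of "?q _" k] by (subst Bochner_Integration.integral_sum) auto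
    finally have q_d: "expectation (\<lambda>\<omega>. \<Sum>i\<in>UNIV. ?q i (X (Suc k) \<omega>) (X k \<omega>)) = m * d (Suc k)"
      using m_pos by simp
    have "s (Suc k) \<le> expectation (\<lambda>\<omega>. 2 * (\<Sum>i\<in>UNIV. ?q i (X (Suc k) \<omega>) (X k \<omega>))
        + 2 * \<beta>\<^sup>2 * (norm (X (Suc k) \<omega> - X k \<omega>))\<^sup>2)"
      unfolding s_def
      by (rule integral_mono[OF int1 _ alg.residual_le])
        (intro Bochner_Integration.integrable_add integrable_mult_right int_q int_step)
    also have "\<dots> = 2 * m * d (Suc k) + 2 * \<beta>\<^sup>2 * d k"
      unfolding d_def[of k] using int_q int_step q_d by simp
    finally show ?thesis .
  qed
  \<comment> \<open>The residual bound refers to a preceding iterate and so starts at index 1; the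
    single term \<open>s 0\<close> does not affect summability.\<close>
  have "summable (\<lambda>k. s (Suc k))"
  proof (rule summable_comparison_test')
    show "summable (\<lambda>k. 2 * m * d (Suc k) + 2 * \<beta>\<^sup>2 * d k)"
      using \<open>summable d\<close> by (intro summable_add summable_mult) (simp_all add: summable_Suc_iff)
    show "norm (s (Suc k)) \<le> 2 * m * d (Suc k) + 2 * \<beta>\<^sup>2 * d k" for k
      using s_le[of k] by (simp add: s_def)
  qed
  then have "summable s"
    by (simp add: summable_Suc_iff)

  \<comment> \<open>The rate for the running minimum\<close>
  have int_min: "integrable M (\<lambda>\<omega>. MIN i\<in>{0..k}. ?S (X i \<omega>))" for k
    by (rule integrable_hist[of _ "\<lambda>h. MIN i\<in>{0..k}. ?S (Y h i)" k])
      (intro arg_cong[where f = Min] image_cong refl, simp add: X_hist[of _ _ k])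
  have "a \<in> o(\<lambda>k. 1 / real k)"
  proof (rule antimono_summable_bound_imp_smallo[OF _ _ _ \<open>summable s\<close>])
    show "antimono a"
      unfolding a_def by (intro antimonoI integral_mono int_min Min_antimono image_mono) auto
    show "0 \<le> a k" for k
      unfolding a_def by (intro Bochner_Integration.integral_nonneg) simp
    show "a k \<le> s k" for k
      unfolding a_def s_def by (intro integral_mono int_min int1 Min_le) auto
  qed
  then show ?thesis
    unfolding a_def .
qed

end
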